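(* Let $n\in\mathbb{N}$, $\nu>0$, $u_0\in\mathcal{S}(\mathbb{R}^n)$, and let $u$ be the solution of the heat equation $\partial_t u(x,t)=\nu\Delta u(x,t)$, $u(x,0)=u_0(x)$, given by $u(\cdot,t)=\Theta_{\nu t}*u_0$ for $t>0$. For $\alpha\in\mathbb{N}_0^n$ and $t\ge 0$ let $s_\alpha(t):=\int_{\mathbb{R}^n}x^\alpha u(x,t)\,dx$. Then: (i) For every $\alpha=(\alpha_1,\dots,\alpha_n)\in\mathbb{N}_0^n$, $s_\alpha$ is a polynomial in $t$, i.e. $s_\alpha\in\mathbb{R}[t]$, with $$\deg s_\alpha\le\left\lfloor\frac{\alpha_1}{2}\right\rfloor+\dots+\left\lfloor\frac{\alpha_n}{2}\right\rfloor,$$ and the coefficients of $s_\alpha(t)$ depend only on the moments $s_\beta(0)$ of $u_0$ with $\beta\le\alpha$, i.e. $\beta_j\le\alpha_j$ for all $j=1,\dots,n$. (ii) If $n=1$, then for all $k\in\mathbb{N}_0$ $$s_{2k}(t)=\sum_{j=0}^k\frac{(2k)!}{(2k-2j)!\cdot j!}\,s_{2k-2j}(0)\,(\nu t)^j$$ and $$s_{2k+1}(t)=\sum_{j=0}^k\frac{(2k+1)!}{(2k+1-2j)!\cdot j!}\,s_{2k+1-2j}(0)\,(\nu t)^j.$$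
   Context: $\mathcal{S}(\mathbb{R}^n)$ is the space of (real-valued) Schwartz functions. The heat kernel is $\Theta_{\tau}(x)=(4\pi\tau)^{-n/2}e^{-(x_1^2+\dots+x_n^2)/(4\tau)}$ for $\tau>0$, and $*$ denotes convolution. $\lfloor y\rfloor$ is the largest integer $\le y$. For $u_0\in\mathcal{S}(\mathbb{R}^n)$ one has $u(\cdot,t)\in\mathcal{S}(\mathbb{R}^n)$ for all $t\ge 0$, so all moments exist. The zero polynomial is regarded as satisfying any degree bound. *)

theory Defs
  imports "HOL-Analysis.Analysis" "HOL-Computational_Algebra.Polynomial"
begin

definition partial_deriv :: "'n::finite \<Rightarrow> (real ^ 'n \<Rightarrow> real) \<Rightarrow> real ^ 'n \<Rightarrow> real" where
  "partial_deriv i f x = deriv (\<lambda>h. f (x + h *\<^sub>R axis i 1)) 0"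

text \<open>
  A list of indices \<open>[i1, ..., ik]\<close> encodes the iterated partial derivative with respect to
  the coordinates \<open>i1, ..., ik\<close>.  Lists are used instead of multi-indices because the index
  type carries no order; every multi-index is represented by some list, and for
  smooth functions all lists representing it give the same derivative.
\<close>

definition iter_partial :: "'n::finite list \<Rightarrow> (real ^ 'n \<Rightarrow> real) \<Rightarrow> real ^ 'n \<Rightarrow> real" where
  "iter_partial js f = foldr partial_deriv js f"

text \<open>
  Requiring every iterated partial derivative to be (Frechet) differentiable makes all of them
  exist and be continuous, which is the class \<open>C\<^sup>\<infinity>\<close>.
\<close>

definition smooth_fun :: "(real ^ 'n::finite \<Rightarrow> real) \<Rightarrow> bool" where
  "smooth_fun f \<longleftrightarrow> (\<forall>js x. iter_partial js f differentiable (at x))"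

definition monom_at :: "('n::finite \<Rightarrow> nat) \<Rightarrow> real ^ 'n \<Rightarrow> real" where
  "monom_at \<alpha> x = (\<Prod>i\<in>UNIV. (x $ i) ^ \<alpha> i)"

definition schwartz_space :: "(real ^ 'n::finite \<Rightarrow> real) set" where
  "schwartz_space =
     {f. smooth_fun f \<and> (\<forall>\<alpha> js. \<exists>C. \<forall>x. \<bar>monom_at \<alpha> x * iter_partial js f x\<bar> \<le> C)}"

definition heat_kernel :: "real \<Rightarrow> real ^ 'n::finite \<Rightarrow> real" where
  "heat_kernel \<tau> x =
     (4 * pi * \<tau>) powr (- real CARD('n) / 2) * exp (- (\<Sum>i\<in>UNIV. (x $ i)\<^sup>2) / (4 * \<tau>))"

definition convolve :: "(real ^ 'n::finite \<Rightarrow> real) \<Rightarrow> (real ^ 'n \<Rightarrow> real) \<Rightarrow> real ^ 'n \<Rightarrow> real" where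
  "convolve f g x = (\<integral>y. f (x - y) * g y \<partial>lborel)"

text \<open>
  Only times \<open>t \<ge> 0\<close> are meaningful; \<open>t = 0\<close> is separate because the heat kernel formula
  degenerates there.
\<close>

definition heat_solution :: "real \<Rightarrow> (real ^ 'n::finite \<Rightarrow> real) \<Rightarrow> real ^ 'n \<Rightarrow> real \<Rightarrow> real" where
  "heat_solution \<nu> u0 x t = (if t = 0 then u0 x else convolve (heat_kernel (\<nu> * t)) u0 x)"

definition moment ::
    "real \<Rightarrow> (real ^ 'n::finite \<Rightarrow> real) \<Rightarrow> ('n \<Rightarrow> nat) \<Rightarrow> real \<Rightarrow> real" where
  "moment \<nu> u0 \<alpha> t = (\<integral>x. monom_at \<alpha> x * heat_solution \<nu> u0 x t \<partial>lborel)"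

end

theory Submission
  imports Defs "HOL-Probability.Sinc_Integral"
begin

text \<open>
  By Fubini, the moment \<open>s\<^sub>\<alpha>(t)\<close> is the integral of \<open>u\<^sub>0(y)\<close> against the \<open>\<alpha>\<close>-moment of the Gaussian
  centred at \<open>y\<close> with variance \<open>2\<nu>t\<close> in each coordinate. This Gaussian moment factorises over the
  coordinates into the one-dimensional heat polynomials; expanding their product expresses
  \<open>s\<^sub>\<alpha>(t)\<close> through the initial moments \<open>s\<^sub>\<alpha>\<^sub>-\<^sub>2\<^sub>\<gamma>(0)\<close> with \<open>\<gamma>\<^sub>i \<le> \<lfloor>\<alpha>\<^sub>i/2\<rfloor>\<close>.
\<close>

section \<open>Integrals of products of one-variable functions\<close>

text \<open>\<open>lborel\<close> is the image of the product measure indexed by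
  \<open>Basis\<close> under the map from coordinates to vectors, so Fubini for finite products
  applies once the factors are reindexed along \<open>axis i 1\<close>.\<close>

lemma has_bochner_integral_lborel_vec_prod:
  fixes f :: "'n::finite \<Rightarrow> real \<Rightarrow> real"
  assumes f: "\<And>i. integrable lborel (f i)"
  shows "has_bochner_integral lborel (\<lambda>x::real^'n. \<Prod>i\<in>UNIV. f i (x $ i))
    (\<Prod>i\<in>UNIV. \<integral>x. f i x \<partial>lborel)"
proof -
  interpret product_sigma_finite "\<lambda>_::real^'n. lborel :: real measure" ..
  \<comment> \<open>Off \<open>Basis\<close> the value of \<open>inv\<close> is unspecified, but
    \<open>g b\<close> is still some \<open>f i\<close> and hence integrable for every
    \<open>b\<close>.\<close>
  define g where "g = (\<lambda>b::real^'n. f (inv (\<lambda>i. axis i 1) b))"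
  have inj: "inj (\<lambda>i::'n. axis i (1::real))"
    by (auto intro!: injI simp: axis_eq_axis)
  have Basis: "(Basis :: (real^'n) set) = range (\<lambda>i. axis i 1)"
    by (auto simp: Basis_vec_def)
  have g_axis [simp]: "g (axis i 1) = f i" for i
    using inv_f_f[OF inj, of i] by (simp add: g_def)
  have prod_Basis: "(\<Prod>b\<in>Basis. h b) = (\<Prod>i\<in>UNIV. h (axis i 1))" for h :: "real^'n \<Rightarrow> real"
    unfolding Basis using inj by (simp add: prod.reindex)
  have [measurable]: "f i \<in> borel_measurable borel" for i
    using borel_measurable_integrable[OF f] by simp
  have g: "integrable lborel (g b)" for b
    by (simp add: g_def f)
  have eq: "(\<Prod>i\<in>UNIV. f i ((\<Sum>b\<in>Basis. y b *\<^sub>R b) $ i)) = (\<Prod>b\<in>Basis. g b (y b))"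
    for y :: "real^'n \<Rightarrow> real"
  proof -
    have "(\<Sum>b\<in>Basis. y b *\<^sub>R b) $ i = y (axis i 1)" for i
      using inner_sum_left_Basis[of "axis i 1" y] by (simp add: inner_axis axis_in_Basis_iff)
    then show ?thesis
      by (simp add: prod_Basis)
  qed
  have "has_bochner_integral (\<Pi>\<^sub>M b\<in>(Basis::(real^'n) set). lborel) (\<lambda>y. \<Prod>b\<in>Basis. g b (y b))
      (\<Prod>i\<in>UNIV. \<integral>x. f i x \<partial>lborel)"
    using product_integrable_prod[OF finite_Basis g] product_integral_prod[OF finite_Basis g]
    by (simp add: has_bochner_integral_iff prod_Basis[of "\<lambda>b. \<integral>x. g b x \<partial>lborel"])
  then have "has_bochner_integral (distr (\<Pi>\<^sub>M b\<in>(Basis::(real^'n) set). lborel) borel (\<lambda>y. \<Sum>b\<in>Basis. y b *\<^sub>R b))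
      (\<lambda>x. \<Prod>i\<in>UNIV. f i (x $ i)) (\<Prod>i\<in>UNIV. \<integral>x. f i x \<partial>lborel)"
    by (intro has_bochner_integral_distr) (simp_all add: eq del: sum_component)
  then show ?thesis
    by (simp flip: lborel_eq)
qed

text \<open>Coordinatewise products of this function serve as integrable majorants for Schwartz
  functions.\<close>

lemma integrable_inverse_1_plus_square_lborel: "integrable lborel (\<lambda>x::real. inverse (1 + x\<^sup>2))"
  using integrable_inverse_1_plus_square by (simp add: set_integrable_def einterval_def)

section \<open>Moments of the one-dimensional Gaussian\<close>

text \<open>For \<open>2 * l \<le> a\<close> this is \<open>a choose (2 * l)\<close> times
  \<open>fact (2 * l) / fact l\<close>, the latter being the central moment of order
  \<open>2 * l\<close> of a Gaussian of variance 2.\<close>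

definition heat_moment_coeff :: "nat \<Rightarrow> nat \<Rightarrow> real" where
  "heat_moment_coeff a l = fact a / (fact (a - 2 * l) * fact l)"

text \<open>
  The \<open>a\<close>-th moment of the normal distribution with mean \<open>y\<close> and variance \<open>2\<tau>\<close>, which solves
  \<open>\<partial>\<^sub>\<tau> v = \<partial>\<^sub>y\<^sub>y v\<close> with initial value \<open>y\<^sup>a\<close>.
\<close>
definition heat_poly :: "nat \<Rightarrow> real \<Rightarrow> real \<Rightarrow> real" where
  "heat_poly a \<tau> y = (\<Sum>l\<le>a div 2. heat_moment_coeff a l * \<tau> ^ l * y ^ (a - 2 * l))"

lemma heat_poly_0 [simp]: "heat_poly a 0 y = y ^ a"
proof -
  have "heat_poly a 0 y = (\<Sum>l\<le>a div 2. if l = 0 then y ^ a else 0)"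
    unfolding heat_poly_def by (rule sum.cong) (auto simp: heat_moment_coeff_def)
  then show ?thesis by simp
qed

text \<open>Expand \<open>x ^ a\<close> binomially around the mean \<open>\<mu>\<close> and insert
  the known central moments.\<close>

lemma normal_density_power_moment:
  assumes "\<tau> > 0"
  shows "has_bochner_integral lborel (\<lambda>x. normal_density \<mu> (sqrt (2 * \<tau>)) x * x ^ a) (heat_poly a \<tau> \<mu>)"
proof -
  define N where "N = normal_density \<mu> (sqrt (2 * \<tau>))"
  \<comment> \<open>The central moments: with variance \<open>2 * \<tau>\<close>, the powers of 2 in
    the usual even moments cancel.\<close>
  define m where "m = (\<lambda>k. if even k then fact k / fact (k div 2) * \<tau> ^ (k div 2) else 0)"
  have \<sigma>: "sqrt (2 * \<tau>) > 0" using assms by simp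
  have m: "has_bochner_integral lborel (\<lambda>x. N x * (x - \<mu>) ^ k) (m k)" for k
  proof (cases "even k")
    case True
    then obtain l where "k = 2 * l" by (elim evenE)
    then show ?thesis
      using normal_moment_even[OF \<sigma>, of \<mu> l] assms
      by (simp add: N_def m_def power_divide field_simps)
  next
    case False
    then obtain l where "k = 2 * l + 1" by (elim oddE)
    then show ?thesis
      using normal_moment_odd[OF \<sigma>, of \<mu> l] by (simp add: N_def m_def)
  qed
  have "has_bochner_integral lborel
      (\<lambda>x. \<Sum>k\<le>a. (real (a choose k) * \<mu> ^ (a - k)) * (N x * (x - \<mu>) ^ k))
      (\<Sum>k\<le>a. (real (a choose k) * \<mu> ^ (a - k)) * m k)"
    by (intro has_bochner_integral_sum has_bochner_integral_mult_right m)
  also have "(\<lambda>x. \<Sum>k\<le>a. (real (a choose k) * \<mu> ^ (a - k)) * (N x * (x - \<mu>) ^ k)) = (\<lambda>x. N x * x ^ a)"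
  proof
    fix x
    show "(\<Sum>k\<le>a. (real (a choose k) * \<mu> ^ (a - k)) * (N x * (x - \<mu>) ^ k)) = N x * x ^ a"
      using binomial_ring[of "x - \<mu>" \<mu> a] by (simp add: sum_distrib_left mult_ac)
  qed
  \<comment> \<open>Odd central moments vanish, so only the indices \<open>k = 2 * l\<close>
    remain.\<close>
  also have "(\<Sum>k\<le>a. (real (a choose k) * \<mu> ^ (a - k)) * m k)
      = (\<Sum>k\<in>(\<lambda>l. 2 * l) ` {..a div 2}. (real (a choose k) * \<mu> ^ (a - k)) * m k)"
    by (rule sum.mono_neutral_right) (auto simp: m_def elim!: evenE)
  also have "\<dots> = heat_poly a \<tau> \<mu>"
    unfolding heat_poly_def
    by (subst sum.reindex)
       (auto simp: inj_on_def m_def heat_moment_coeff_def binomial_fact intro!: sum.cong)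
  finally show ?thesis by (simp add: N_def)
qed

section \<open>Moments of the heat kernel\<close>

text \<open>The exponential of the sum splits over the coordinates, and the normalising constant is
  a product of factors \<open>1 / sqrt (4 * pi * \<tau>)\<close>, each that of a Gaussian of
  variance \<open>2 * \<tau>\<close>.\<close>

lemma heat_kernel_diff_eq_prod:
  fixes x y :: "real ^ 'n::finite"
  assumes "\<tau> > 0"
  shows "heat_kernel \<tau> (x - y) = (\<Prod>i\<in>UNIV. normal_density (y $ i) (sqrt (2 * \<tau>)) (x $ i))"
proof -
  have "(4 * pi * \<tau>) powr (- real CARD('n) / 2) = (1 / sqrt (4 * pi * \<tau>)) ^ CARD('n)"
  proof -
    have "(1 / sqrt (4 * pi * \<tau>)) ^ CARD('n) = ((4 * pi * \<tau>) powr (- 1 / 2)) powr real CARD('n)"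
      using assms by (simp add: powr_realpow powr_minus_divide powr_half_sqrt)
    then show ?thesis
      by (simp add: powr_powr)
  qed
  then show ?thesis
    using assms
    by (simp add: heat_kernel_def normal_density_def exp_sum sum_divide_distrib
        prod_dividef mult.assoc power_divide flip: sum_negf)
qed

lemma heat_kernel_nonneg: "heat_kernel \<tau> x \<ge> 0"
  by (simp add: heat_kernel_def)

lemma monom_heat_kernel_integral:
  fixes y :: "real ^ 'n::finite"
  assumes "\<tau> > 0"
  shows "has_bochner_integral lborel (\<lambda>x. monom_at \<alpha> x * heat_kernel \<tau> (x - y))
    (\<Prod>i\<in>UNIV. heat_poly (\<alpha> i) \<tau> (y $ i))"
proof -
  note normal_moment = normal_density_power_moment[OF assms]
  show ?thesis
    using has_bochner_integral_lborel_vec_prod[of "\<lambda>i x. normal_density (y $ i) (sqrt (2 * \<tau>)) x * x ^ \<alpha> i"]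
      normal_moment[THEN has_bochner_integral_integral_eq] normal_moment[THEN integrable.intros]
    by (simp add: heat_kernel_diff_eq_prod[OF assms] monom_at_def prod.distrib mult.commute)
qed

lemma borel_measurable_monom_at [measurable]: "monom_at \<alpha> \<in> borel_measurable borel"
  unfolding monom_at_def[abs_def] by measurable

lemma borel_measurable_heat_kernel [measurable]: "heat_kernel \<tau> \<in> borel_measurable borel"
  unfolding heat_kernel_def[abs_def] by measurable

text \<open>Distributivity: \<open>\<gamma>\<close> records which summand is taken from each factor,
  and the exponents of \<open>\<tau>\<close> add up.\<close>

lemma prod_heat_poly:
  "(\<Prod>i\<in>UNIV. heat_poly (\<alpha> i) \<tau> (y $ i)) =
    (\<Sum>\<gamma>\<in>(\<Pi>\<^sub>E i\<in>UNIV. {..\<alpha> i div 2}).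
      (\<Prod>i\<in>UNIV. heat_moment_coeff (\<alpha> i) (\<gamma> i)) * \<tau> ^ (\<Sum>i\<in>UNIV. \<gamma> i)
        * monom_at (\<lambda>i. \<alpha> i - 2 * \<gamma> i) y)"
  unfolding heat_poly_def
  by (subst prod_sum_PiE) (simp_all add: prod.distrib monom_at_def power_sum)

section \<open>Integrability of Schwartz functions against monomials\<close>

lemma schwartz_measurable:
  assumes "u \<in> schwartz_space"
  shows "u \<in> borel_measurable borel"
proof -
  have "iter_partial [] u differentiable at x" for x
    using assms unfolding schwartz_space_def smooth_fun_def by blast
  then have "continuous_on UNIV u"
    by (simp add: iter_partial_def differentiable_imp_continuous_within continuous_on_eq_continuous_within)
  then show ?thesis
    by (rule borel_measurable_continuous_onI)
qed

lemma schwartz_bounded: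
  assumes "u \<in> schwartz_space"
  obtains C where "\<And>x. \<bar>monom_at \<alpha> x * u x\<bar> \<le> C"
proof -
  have "\<exists>C. \<forall>x. \<bar>monom_at \<alpha> x * iter_partial [] u x\<bar> \<le> C"
    using assms unfolding schwartz_space_def by blast
  then show ?thesis
    using that by (auto simp: iter_partial_def)
qed

lemma monom_at_mult: "monom_at \<alpha> x * monom_at \<beta> x = monom_at (\<lambda>i. \<alpha> i + \<beta> i) x"
  by (simp add: monom_at_def power_add prod.distrib)

text \<open>Multiplying by the product of all \<open>1 + (x $ i)\<^sup>2\<close> keeps the function
  bounded, so it is dominated by a constant times the product of the reciprocals.\<close>

lemma schwartz_monom_integrable:
  fixes u :: "real ^ 'n::finite \<Rightarrow> real"
  assumes "u \<in> schwartz_space"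
  shows "integrable lborel (\<lambda>x. monom_at \<alpha> x * u x)"
proof -
  have [measurable]: "u \<in> borel_measurable borel"
    using assms by (rule schwartz_measurable)
  \<comment> \<open>Each \<open>\<gamma>\<close> chooses, for every coordinate, the summand 1 or
    \<open>(x $ i)\<^sup>2\<close>.\<close>
  define G where "G = (\<Pi>\<^sub>E i\<in>(UNIV :: 'n set). {..1::nat})"
  have expand: "(\<Prod>i\<in>UNIV. 1 + (x $ i)\<^sup>2) = (\<Sum>\<gamma>\<in>G. monom_at (\<lambda>i. 2 * \<gamma> i) x)"
    for x :: "real ^ 'n"
  proof -
    have "(\<Prod>i\<in>UNIV. 1 + (x $ i)\<^sup>2) = (\<Prod>i\<in>UNIV. \<Sum>k\<le>1. ((x $ i)\<^sup>2) ^ k)"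
      by simp
    also have "\<dots> = (\<Sum>\<gamma>\<in>G. monom_at (\<lambda>i. 2 * \<gamma> i) x)"
      unfolding G_def by (subst prod_sum_PiE) (simp_all add: monom_at_def power_mult)
    finally show ?thesis .
  qed
  have "\<exists>C. \<forall>x. \<bar>monom_at (\<lambda>i. \<alpha> i + 2 * \<gamma> i) x * u x\<bar> \<le> C" for \<gamma>
    using schwartz_bounded[OF assms] by metis
  then obtain C where C: "\<And>\<gamma> x. \<bar>monom_at (\<lambda>i. \<alpha> i + 2 * \<gamma> i) x * u x\<bar> \<le> C \<gamma>"
    by metis
  \<comment> \<open>Each term of the expanded product times \<open>x\<^sup>\<alpha> u(x)\<close> is one of the bounded Schwartz seminorms.\<close>
  have bound: "\<bar>monom_at \<alpha> x * u x\<bar> \<le> (\<Sum>\<gamma>\<in>G. C \<gamma>) * (\<Prod>i\<in>UNIV. inverse (1 + (x $ i)\<^sup>2))"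
    for x :: "real ^ 'n"
  proof -
    have pos: "(\<Prod>i\<in>UNIV. 1 + (x $ i)\<^sup>2) > 0"
      by (intro prod_pos) (simp add: add_pos_nonneg)
    have "\<bar>monom_at \<alpha> x * u x\<bar> * (\<Prod>i\<in>UNIV. 1 + (x $ i)\<^sup>2)
        = \<bar>monom_at \<alpha> x * u x * (\<Prod>i\<in>UNIV. 1 + (x $ i)\<^sup>2)\<bar>"
      using pos by (simp add: abs_mult)
    also have "\<dots> = \<bar>\<Sum>\<gamma>\<in>G. monom_at (\<lambda>i. \<alpha> i + 2 * \<gamma> i) x * u x\<bar>"
      unfolding expand sum_distrib_left monom_at_mult[symmetric] by (simp add: mult_ac)
    also have "\<dots> \<le> (\<Sum>\<gamma>\<in>G. C \<gamma>)"
      by (rule order_trans[OF sum_abs sum_mono]) (rule C)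
    finally show ?thesis
      using pos prod_inversef[of "\<lambda>i. 1 + (x $ i)\<^sup>2" UNIV]
      by (simp add: pos_le_divide_eq divide_inverse[symmetric] o_def)
  qed
  have "integrable lborel (\<lambda>x::real ^ 'n. \<Prod>i\<in>UNIV. inverse (1 + (x $ i)\<^sup>2))"
    by (rule integrable.intros[OF has_bochner_integral_lborel_vec_prod])
       (rule integrable_inverse_1_plus_square_lborel)
  then have "integrable lborel (\<lambda>x::real ^ 'n. (\<Sum>\<gamma>\<in>G. C \<gamma>) * (\<Prod>i\<in>UNIV. inverse (1 + (x $ i)\<^sup>2)))"
    by (rule integrable_mult_right)
  then show ?thesis
    by (rule Bochner_Integration.integrable_bound) (auto intro!: AE_I2 order_trans[OF bound abs_ge_self])
qed

section \<open>Moments of the heat solution\<close>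

text \<open>Integrate the expanded product termwise; at time 0 \<open>moment\<close> is the plain
  moment of \<open>u\<close>, whatever \<open>\<nu>\<close> is.\<close>

lemma schwartz_prod_heat_poly_integral:
  fixes u :: "real ^ 'n::finite \<Rightarrow> real"
  assumes "u \<in> schwartz_space"
  shows "has_bochner_integral lborel (\<lambda>y. (\<Prod>i\<in>UNIV. heat_poly (\<alpha> i) \<tau> (y $ i)) * u y)
    (\<Sum>\<gamma>\<in>(\<Pi>\<^sub>E i\<in>UNIV. {..\<alpha> i div 2}).
      (\<Prod>i\<in>UNIV. heat_moment_coeff (\<alpha> i) (\<gamma> i)) * \<tau> ^ (\<Sum>i\<in>UNIV. \<gamma> i)
        * moment \<nu> u (\<lambda>i. \<alpha> i - 2 * \<gamma> i) 0)"
  unfolding prod_heat_poly sum_distrib_right mult.assoc[of _ "monom_at _ _"]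
  by (intro has_bochner_integral_sum has_bochner_integral_mult_right)
     (simp add: moment_def heat_solution_def has_bochner_integral_iff schwartz_monom_integrable[OF assms])

text \<open>For \<open>t > 0\<close>, Fubini lets the Gaussian be integrated first; at
  \<open>t = 0\<close> the heat polynomials reduce to powers.\<close>

lemma moment_eq_integral_heat_poly:
  fixes u :: "real ^ 'n::finite \<Rightarrow> real"
  assumes u: "u \<in> schwartz_space" and "\<nu> > 0" "t \<ge> 0"
  shows "moment \<nu> u \<alpha> t = (\<integral>y. (\<Prod>i\<in>UNIV. heat_poly (\<alpha> i) (\<nu> * t) (y $ i)) * u y \<partial>lborel)"
proof (cases "t = 0")
  case True
  then show ?thesis
    by (simp add: moment_def heat_solution_def monom_at_def)
next
  case False
  define \<tau> where "\<tau> = \<nu> * t"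
  have \<tau>: "\<tau> > 0"
    using assms False by (simp add: \<tau>_def)
  have [measurable]: "u \<in> borel_measurable borel"
    using u by (rule schwartz_measurable)
  \<comment> \<open>The exponent \<open>\<beta>\<close> stays free because the domination below uses
    exponents other than \<open>\<alpha>\<close>.\<close>
  define q where "q = (\<lambda>\<beta> (y::real ^ 'n). \<Prod>i\<in>UNIV. heat_poly (\<beta> i) \<tau> (y $ i))"
  have q: "has_bochner_integral lborel (\<lambda>x. monom_at \<beta> x * heat_kernel \<tau> (x - y)) (q \<beta> y)" for \<beta> y
    unfolding q_def using \<tau> by (rule monom_heat_kernel_integral)
  have q_int: "integrable lborel (\<lambda>y. q \<beta> y * u y)" for \<beta>
    unfolding q_def using schwartz_prod_heat_poly_integral[OF u] by (rule integrable.intros)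
  have [measurable]: "q \<beta> \<in> borel_measurable borel" for \<beta>
    unfolding q_def heat_poly_def by measurable
  have q_int': "integrable lborel (\<lambda>y. q \<beta> y * \<bar>u y\<bar>)" for \<beta>
    by (rule Bochner_Integration.integrable_bound[OF q_int[of \<beta>]]) (auto simp: abs_mult)
  \<comment> \<open>With \<open>\<bar>u y\<bar>\<close> and a nonnegative monomial, \<open>G\<close>
    equals its own norm, so its inner integral is known exactly.\<close>
  define G where "G = (\<lambda>\<beta> (y, x). monom_at \<beta> x * heat_kernel \<tau> (x - y) * \<bar>u y\<bar>)"
  have G_int: "integrable (lborel \<Otimes>\<^sub>M lborel) (G \<beta>)" if nonneg: "\<And>x. monom_at \<beta> x \<ge> 0" for \<beta>
  proof (rule lborel_pair.Fubini_integrable)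
    show "G \<beta> \<in> borel_measurable (lborel \<Otimes>\<^sub>M lborel)"
      unfolding G_def by measurable
    have "norm (G \<beta> (y, x)) = G \<beta> (y, x)" for x y
      by (simp add: G_def nonneg heat_kernel_nonneg)
    moreover have *: "has_bochner_integral lborel (\<lambda>x. G \<beta> (y, x)) (q \<beta> y * \<bar>u y\<bar>)" for y
      unfolding G_def prod.case using q by (rule has_bochner_integral_mult_left)
    ultimately show "integrable lborel (\<lambda>y. \<integral>x. norm (G \<beta> (y, x)) \<partial>lborel)"
      using q_int' by (simp add: has_bochner_integral_integral_eq[OF *])
    show "AE y in lborel. integrable lborel (\<lambda>x. G \<beta> (y, x))"
      using * by (auto intro: integrable.intros)
  qed
  define F where "F = (\<lambda>y x. monom_at \<alpha> x * heat_kernel \<tau> (x - y) * u y)"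
  \<comment> \<open>Even exponents avoid absolute Gaussian moments: \<open>|x\<^sup>\<alpha>| \<le> 1 + x\<^sup>2\<^sup>\<alpha>\<close>.\<close>
  have "integrable (lborel \<Otimes>\<^sub>M lborel) (\<lambda>p. G (\<lambda>_. 0) p + G (\<lambda>i. 2 * \<alpha> i) p)"
    by (intro Bochner_Integration.integrable_add G_int)
       (auto simp: monom_at_def power_mult intro!: prod_nonneg)
  then have F_int: "integrable (lborel \<Otimes>\<^sub>M lborel) (case_prod F)"
  proof (rule Bochner_Integration.integrable_bound)
    show "case_prod F \<in> borel_measurable (lborel \<Otimes>\<^sub>M lborel)"
      unfolding F_def by measurable
    have "norm (F y x) \<le> norm (G (\<lambda>_. 0) (y, x) + G (\<lambda>i. 2 * \<alpha> i) (y, x))" for x y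
    proof -
      have "\<bar>monom_at \<alpha> x\<bar> \<le> 1 + (monom_at \<alpha> x)\<^sup>2"
        using sum_squares_bound[of "\<bar>monom_at \<alpha> x\<bar>" 1] by simp
      also have "\<dots> = monom_at (\<lambda>_. 0) x + monom_at (\<lambda>i. 2 * \<alpha> i) x"
        by (simp add: power2_eq_square monom_at_mult mult_2) (simp add: monom_at_def)
      finally have "\<bar>monom_at \<alpha> x\<bar> \<le> monom_at (\<lambda>_. 0) x + monom_at (\<lambda>i. 2 * \<alpha> i) x" .
      then have "\<bar>monom_at \<alpha> x\<bar> * (heat_kernel \<tau> (x - y) * \<bar>u y\<bar>) \<le>
          (monom_at (\<lambda>_. 0) x + monom_at (\<lambda>i. 2 * \<alpha> i) x) * (heat_kernel \<tau> (x - y) * \<bar>u y\<bar>)"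
        by (rule mult_right_mono) (simp add: heat_kernel_nonneg)
      then show ?thesis
        by (simp add: F_def G_def abs_mult heat_kernel_nonneg algebra_simps)
    qed
    then show "AE p in lborel \<Otimes>\<^sub>M lborel.
        norm (case_prod F p) \<le> norm (G (\<lambda>_. 0) p + G (\<lambda>i. 2 * \<alpha> i) p)"
      by auto
  qed
  \<comment> \<open>The convolution has \<open>y\<close> as inner variable; after the exchange the
    inner integral is the Gaussian moment \<open>q \<alpha> y\<close> times
    \<open>u y\<close>.\<close>
  have "moment \<nu> u \<alpha> t = (\<integral>x. \<integral>y. F y x \<partial>lborel \<partial>lborel)"
    using False by (simp add: moment_def heat_solution_def convolve_def F_def \<tau>_def mult.assoc)
  also have "\<dots> = (\<integral>y. \<integral>x. F y x \<partial>lborel \<partial>lborel)"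
    using F_int by (rule lborel_pair.Fubini_integral)
  also have "\<dots> = (\<integral>y. q \<alpha> y * u y \<partial>lborel)"
    using q[of \<alpha>, THEN has_bochner_integral_integral_eq] by (simp add: F_def)
  finally show ?thesis
    by (simp add: q_def \<tau>_def)
qed

lemma moment_expansion:
  fixes u :: "real ^ 'n::finite \<Rightarrow> real"
  assumes "u \<in> schwartz_space" "\<nu> > 0" "t \<ge> 0"
  shows "moment \<nu> u \<alpha> t =
    (\<Sum>\<gamma>\<in>(\<Pi>\<^sub>E i\<in>UNIV. {..\<alpha> i div 2}).
      (\<Prod>i\<in>UNIV. heat_moment_coeff (\<alpha> i) (\<gamma> i)) * (\<nu> * t) ^ (\<Sum>i\<in>UNIV. \<gamma> i)
        * moment \<nu> u (\<lambda>i. \<alpha> i - 2 * \<gamma> i) 0)"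
  using moment_eq_integral_heat_poly[OF assms]
    schwartz_prod_heat_poly_integral[OF assms(1), THEN has_bochner_integral_integral_eq]
  by simp

text \<open>Starting from the integral formula, where the product over a one-element index type is a
  single factor, avoids reindexing a sum over functions \<open>\<gamma>\<close>.\<close>

lemma moment_expansion_1:
  fixes u :: "real ^ 'n::finite \<Rightarrow> real"
  assumes "CARD('n) = 1" "u \<in> schwartz_space" "\<nu> > 0" "t \<ge> 0"
  shows "moment \<nu> u (\<lambda>_. a) t =
    (\<Sum>l\<le>a div 2. heat_moment_coeff a l * moment \<nu> u (\<lambda>_. a - 2 * l) 0 * (\<nu> * t) ^ l)"
proof -
  obtain i :: 'n where i: "UNIV = {i}"
    using assms(1) by (auto simp: card_1_singleton_iff)
  have "moment \<nu> u (\<lambda>_. a) t = (\<integral>y. heat_poly a (\<nu> * t) (y $ i) * u y \<partial>lborel)"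
    using moment_eq_integral_heat_poly[OF assms(2-)] by (simp add: i)
  also have "\<dots> = (\<integral>y. (\<Sum>l\<le>a div 2. heat_moment_coeff a l * (\<nu> * t) ^ l *
      (monom_at (\<lambda>_. a - 2 * l) y * u y)) \<partial>lborel)"
    by (simp add: heat_poly_def sum_distrib_right monom_at_def i mult.assoc)
  also have "\<dots> = (\<Sum>l\<le>a div 2. heat_moment_coeff a l * moment \<nu> u (\<lambda>_. a - 2 * l) 0 * (\<nu> * t) ^ l)"
    using schwartz_monom_integrable[OF assms(2)]
    by (subst Bochner_Integration.integral_sum)
       (auto simp: moment_def heat_solution_def intro!: sum.cong)
  finally show ?thesis .
qed



section \<open>Polynomial dependence on time and the one-dimensional formulas\<close>

text \<open>Choosing \<open>P\<close> before \<open>u0\<close> and feeding it only the restricted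
  initial moments expresses that the coefficients depend on nothing else about
  \<open>u0\<close>.\<close>

theorem lemma2p1:
  fixes \<nu> :: real
  assumes "\<nu> > 0"
  shows
    "(\<forall>\<alpha> :: 'n::finite \<Rightarrow> nat.
        \<exists>P :: (('n \<Rightarrow> nat) \<Rightarrow> real) \<Rightarrow> real poly.
          \<forall>u0 :: real ^ 'n \<Rightarrow> real. u0 \<in> schwartz_space \<longrightarrow>
            (let p = P (restrict (\<lambda>\<beta>. moment \<nu> u0 \<beta> 0) {\<beta>. \<forall>j. \<beta> j \<le> \<alpha> j}) in
               degree p \<le> (\<Sum>j\<in>UNIV. \<alpha> j div 2) \<and>
               (\<forall>t\<ge>0. moment \<nu> u0 \<alpha> t = poly p t)))
     \<and>
     (CARD('n) = 1 \<longrightarrow>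
        (\<forall>u0 :: real ^ 'n \<Rightarrow> real. u0 \<in> schwartz_space \<longrightarrow>
          (\<forall>k. \<forall>t\<ge>0.
             moment \<nu> u0 (\<lambda>_. 2 * k) t =
               (\<Sum>j = 0..k. fact (2 * k) / (fact (2 * k - 2 * j) * fact j)
                  * moment \<nu> u0 (\<lambda>_. 2 * k - 2 * j) 0 * (\<nu> * t) ^ j) \<and>
             moment \<nu> u0 (\<lambda>_. 2 * k + 1) t =
               (\<Sum>j = 0..k. fact (2 * k + 1) / (fact (2 * k + 1 - 2 * j) * fact j)
                  * moment \<nu> u0 (\<lambda>_. 2 * k + 1 - 2 * j) 0 * (\<nu> * t) ^ j))))"
proof (intro conjI allI impI)
  fix \<alpha> :: "'n \<Rightarrow> nat"
  define B where "B = {\<beta>. \<forall>j. \<beta> j \<le> \<alpha> j}"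
  define \<Gamma> where "\<Gamma> = (\<Pi>\<^sub>E i\<in>UNIV. {..\<alpha> i div 2})"
  \<comment> \<open>Read off from \<open>moment_expansion\<close>: \<open>m\<close> stands for the
    initial moments, and the power of \<open>\<nu> * t\<close> is split so that \<open>\<nu>\<close>
    enters the coefficient.\<close>
  define P where "P = (\<lambda>m :: ('n \<Rightarrow> nat) \<Rightarrow> real. \<Sum>\<gamma>\<in>\<Gamma>.
    monom ((\<Prod>i\<in>UNIV. heat_moment_coeff (\<alpha> i) (\<gamma> i)) * \<nu> ^ (\<Sum>i\<in>UNIV. \<gamma> i)
      * m (\<lambda>i. \<alpha> i - 2 * \<gamma> i)) (\<Sum>i\<in>UNIV. \<gamma> i))"
  have "degree (P m) \<le> (\<Sum>j\<in>UNIV. \<alpha> j div 2)" for m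
    unfolding P_def
  proof (intro degree_sum_le)
    show "finite \<Gamma>"
      by (simp add: \<Gamma>_def finite_PiE)
    fix \<gamma> assume "\<gamma> \<in> \<Gamma>"
    then have "(\<Sum>i\<in>UNIV. \<gamma> i) \<le> (\<Sum>j\<in>UNIV. \<alpha> j div 2)"
      by (intro sum_mono) (auto simp: \<Gamma>_def PiE_iff)
    then show "degree (monom ((\<Prod>i\<in>UNIV. heat_moment_coeff (\<alpha> i) (\<gamma> i)) * \<nu> ^ (\<Sum>i\<in>UNIV. \<gamma> i)
        * m (\<lambda>i. \<alpha> i - 2 * \<gamma> i)) (\<Sum>i\<in>UNIV. \<gamma> i)) \<le> (\<Sum>j\<in>UNIV. \<alpha> j div 2)"
      using degree_monom_le order_trans by blast
  qed
  \<comment> \<open>Every index \<open>\<alpha> i - 2 * \<gamma> i\<close> is at most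
    \<open>\<alpha> i\<close>, so \<open>restrict\<close> returns actual moments and never
    \<open>undefined\<close>.\<close>
  moreover have "moment \<nu> u \<alpha> t = poly (P (restrict (\<lambda>\<beta>. moment \<nu> u \<beta> 0) B)) t"
    if "u \<in> schwartz_space" "t \<ge> 0" for u :: "real ^ 'n \<Rightarrow> real" and t
    using moment_expansion[OF that(1) assms that(2), of \<alpha>]
    by (simp add: P_def poly_sum poly_monom B_def \<Gamma>_def power_mult_distrib mult_ac)
  ultimately show "\<exists>P :: (('n \<Rightarrow> nat) \<Rightarrow> real) \<Rightarrow> real poly.
      \<forall>u0 :: real ^ 'n \<Rightarrow> real. u0 \<in> schwartz_space \<longrightarrow>
        (let p = P (restrict (\<lambda>\<beta>. moment \<nu> u0 \<beta> 0) {\<beta>. \<forall>j. \<beta> j \<le> \<alpha> j}) in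
           degree p \<le> (\<Sum>j\<in>UNIV. \<alpha> j div 2) \<and>
           (\<forall>t\<ge>0. moment \<nu> u0 \<alpha> t = poly p t))"
    unfolding B_def by (intro exI[of _ P]) (simp add: Let_def)
next
  fix u0 :: "real ^ 'n \<Rightarrow> real" and k :: nat and t :: real
  assume "CARD('n) = 1" "u0 \<in> schwartz_space" "t \<ge> 0"
  \<comment> \<open>For both \<open>a = 2 * k\<close> and \<open>a = 2 * k + 1\<close> the upper
    limit \<open>a div 2\<close> is \<open>k\<close>.\<close>
  note expansion = moment_expansion_1[OF this(1,2) assms this(3)]
  show "moment \<nu> u0 (\<lambda>_. 2 * k) t =
      (\<Sum>j = 0..k. fact (2 * k) / (fact (2 * k - 2 * j) * fact j)
        * moment \<nu> u0 (\<lambda>_. 2 * k - 2 * j) 0 * (\<nu> * t) ^ j)"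
    using expansion[of "2 * k"] by (simp add: heat_moment_coeff_def atLeast0AtMost)
  show "moment \<nu> u0 (\<lambda>_. 2 * k + 1) t =
      (\<Sum>j = 0..k. fact (2 * k + 1) / (fact (2 * k + 1 - 2 * j) * fact j)
        * moment \<nu> u0 (\<lambda>_. 2 * k + 1 - 2 * j) 0 * (\<nu> * t) ^ j)"
    using expansion[of "2 * k + 1"] by (simp add: heat_moment_coeff_def atLeast0AtMost del: fact_Suc)
qed

end
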